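(* Let $m$ be an even positive integer, $q=2^{m/2}$, let $r\ge 1$ be an integer, and let $b,c\in\mathbb{F}_{q^2}$ with $c\neq 0$. Then the polynomial \[ F_{b,c,r}(X,Y)=\left(cX^{2^r+1}+bX^{2^r}+1\right)\left(c^qY^{2^r+1}+b^qY^{2^r}+1\right)-XY \] is absolutely irreducible, i.e. irreducible in $\overline{\mathbb{F}_q}[X,Y]$; equivalently, the plane curve $F_{b,c,r}(X,Y)=0$ is absolutely irreducible.
   Context: $\overline{\mathbb{F}_q}$ denotes an algebraic closure of $\mathbb{F}_q$. *)

theory Defs
  imports
    "HOL-Algebra.Algebraic_Closure_Type"
    "HOL-Computational_Algebra.Polynomial_Factorial"
    "HOL-Library.Cardinality"
begin

text \<open>
  A polynomial in $K[X,Y]$ is an element of type \<open>'a poly poly\<close>, read as $K[X][Y]$: the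
  coefficients are polynomials in \<open>X\<close>, the outer variable is \<open>Y\<close>.
\<close>

definition bconst :: "'a::comm_ring_1 \<Rightarrow> 'a poly poly" where
  "bconst a = [:[:a:]:]"

definition bX :: "'a::comm_ring_1 poly poly" where
  "bX = [:[:0, 1:]:]"

definition bY :: "'a::comm_ring_1 poly poly" where
  "bY = [:0, 1:]"

definition F_poly :: "nat \<Rightarrow> 'a::comm_ring_1 \<Rightarrow> 'a \<Rightarrow> nat \<Rightarrow> 'a poly poly" where
  "F_poly q b c r =
     (bconst c * bX ^ (2 ^ r + 1) + bconst b * bX ^ (2 ^ r) + 1) *
     (bconst (c ^ q) * bY ^ (2 ^ r + 1) + bconst (b ^ q) * bY ^ (2 ^ r) + 1) - bX * bY"

lemma poly_poly_F_poly:
  "poly (poly (F_poly q b c r) [:y:]) x =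
     (c * x ^ (2 ^ r + 1) + b * x ^ (2 ^ r) + 1) *
     (c ^ q * y ^ (2 ^ r + 1) + b ^ q * y ^ (2 ^ r) + 1) - x * y"
  by (simp add: F_poly_def bconst_def bX_def bY_def poly_power algebra_simps)

text \<open>
  The qualified name selects the type-class notion of irreducibility: HOL-Algebra declares a
  constant of the same name for record-based monoids.
\<close>

definition absolutely_irreducible :: "'a::field poly poly \<Rightarrow> bool" where
  "absolutely_irreducible P \<longleftrightarrow>
     Factorial_Ring.irreducible (map_poly (map_poly to_ac) P :: 'a alg_closure poly poly)"

end

theory Submission
  imports Defs "HOL-Number_Theory.Residues"
begin

text \<open>
  Write $F = P(X) R(Y) - XY$. At a root $\alpha$ of $P$ the polynomial $F(\alpha, Y)$ collapses to
  $-\alpha Y$, so a factor of $F$ whose leading coefficient in $Y$ does not vanish at $\alpha$ has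
  $Y$-degree at most 1. If $F = GH$, the leading coefficients of $G$ and $H$ multiply to a constant
  multiple of the separable polynomial $P$. Hence the factor $H$ of larger $Y$-degree carries all of
  $P$ in its leading coefficient, and $G$ has constant leading coefficient and $Y$-degree at most 1.
  If that degree were 1, then $F(X, s(X)) = 0$ for a polynomial $s$, which is impossible by
  comparing degrees in $P \cdot R(s) = X s$.
\<close>

lemma map_poly_add_hom:
  fixes f :: "'a::comm_ring_1 \<Rightarrow> 'b::comm_ring_1"
  assumes "f 0 = 0" "\<And>x y. f (x + y) = f x + f y"
  shows "map_poly f (p + q) = map_poly f p + map_poly f q"
  using assms by (intro poly_eqI) (simp add: coeff_map_poly)

lemma map_poly_diff_hom:
  fixes f :: "'a::comm_ring_1 \<Rightarrow> 'b::comm_ring_1"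
  assumes "f 0 = 0" "\<And>x y. f (x - y) = f x - f y"
  shows "map_poly f (p - q) = map_poly f p - map_poly f q"
  using assms by (intro poly_eqI) (simp add: coeff_map_poly)

text \<open>Serves two kinds of coefficient map: evaluation at \<alpha>, and \<open>to_ac\<close>
  pushed through both levels of a bivariate polynomial.\<close>

lemma map_poly_mult_hom:
  fixes f :: "'a::comm_ring_1 \<Rightarrow> 'b::comm_ring_1"
  assumes "f 0 = 0" "\<And>x y. f (x + y) = f x + f y" "\<And>x y. f (x * y) = f x * f y"
  shows "map_poly f (p * q) = map_poly f p * map_poly f q"
proof (intro poly_eqI)
  fix n
  have "f (sum g A) = (\<Sum>i\<in>A. f (g i))" for g and A :: "nat set"
    by (induction A rule: infinite_finite_induct) (simp_all add: assms)
  then show "coeff (map_poly f (p * q)) n = coeff (map_poly f p * map_poly f q) n"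
    by (simp add: assms coeff_map_poly coeff_mult)
qed

lemma map_poly_power_hom:
  fixes f :: "'a::comm_ring_1 \<Rightarrow> 'b::comm_ring_1"
  assumes "f 0 = 0" "f 1 = 1" "\<And>x y. f (x + y) = f x + f y" "\<And>x y. f (x * y) = f x * f y"
  shows "map_poly f (p ^ n) = map_poly f p ^ n"
  by (induction n) (simp_all add: assms map_poly_mult_hom)

text \<open>The argument sees the two trinomials only through their degrees, their values at 0 and
  the separability of the first, so it is run for this general shape.\<close>

definition separated_poly :: "'a::comm_ring_1 poly \<Rightarrow> 'a poly \<Rightarrow> 'a poly poly" where
  "separated_poly P R = [:P:] * map_poly (\<lambda>a. [:a:]) R - bX * bY"

lemma coeff_separated_poly:
  "coeff (separated_poly P R) k = smult (coeff R k) P - (if k = 1 then [:0, 1:] else 0)"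
  by (cases k) (auto simp: separated_poly_def coeff_map_poly bX_def bY_def coeff_pCons
      split: nat.split)

lemma poly_separated_poly:
  "poly (separated_poly P R) s = P * pcompose R s - [:0, 1:] * s"
  by (simp add: separated_poly_def pcompose_altdef bX_def bY_def)

text \<open>The term -XY has Y-degree 1, so it cannot disturb the leading coefficient once
  \<open>R\<close> has degree at least 2.\<close>

lemma degree_separated_poly:
  fixes P R :: "'a::field poly"
  assumes "P \<noteq> 0" "degree R \<ge> 2"
  shows "degree (separated_poly P R) = degree R"
proof (rule antisym)
  show "degree (separated_poly P R) \<le> degree R"
    using assms by (intro degree_le) (auto simp: coeff_separated_poly coeff_eq_0)
  have "R \<noteq> 0" using assms(2) by auto
  then show "degree R \<le> degree (separated_poly P R)"
    using assms by (intro le_degree) (auto simp: coeff_separated_poly)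
qed

lemma map_poly_eval_separated_poly:
  assumes "poly P \<alpha> = 0"
  shows "map_poly (\<lambda>p. poly p \<alpha>) (separated_poly P R) = [:0, - \<alpha>:]"
  using assms
  by (intro poly_eqI) (auto simp: coeff_map_poly coeff_separated_poly coeff_pCons split: nat.split)

text \<open>Since \<open>P\<close> does not vanish at 0, \<alpha> is nonzero, so specialising X to
  \<alpha> leaves a nonzero product of degree 1. The specialised \<open>G\<close> divides it and has
  kept its degree.\<close>

lemma degree_factor_separated_poly_le_1:
  fixes P R :: "'a::field poly"
  assumes "separated_poly P R = G * H" "poly P 0 \<noteq> 0"
    and "poly P \<alpha> = 0" "poly (lead_coeff G) \<alpha> \<noteq> 0"
  shows "degree G \<le> 1"
proof -
  let ?ev = "map_poly (\<lambda>p. poly p \<alpha>)"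
  have "\<alpha> \<noteq> 0" using assms by auto
  have eq: "[:0, - \<alpha>:] = ?ev G * ?ev H"
    using map_poly_eval_separated_poly[OF assms(3), of R]
    by (simp add: assms(1) map_poly_mult_hom)
  then have "?ev G dvd [:0, - \<alpha>:]" by simp
  then have "degree (?ev G) \<le> degree [:0, - \<alpha>:]"
    using \<open>\<alpha> \<noteq> 0\<close> by (intro dvd_imp_degree_le) auto
  moreover have "degree (?ev G) = degree G"
    using assms(4) by (intro map_poly_degree_eq) auto
  ultimately show ?thesis using \<open>\<alpha> \<noteq> 0\<close> by simp
qed

lemma smaller_factor_separated_poly_is_unit:
  fixes P R :: "'a::alg_closed_field poly"
  assumes FGH: "separated_poly P R = G * H" and le: "degree G \<le> degree H"
    and P0: "poly P 0 \<noteq> 0" and R0: "poly R 0 \<noteq> 0"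
    and degP: "degree P \<ge> 1" and degR: "degree R \<ge> 3"
    and sep: "\<And>x. poly P x = 0 \<Longrightarrow> poly (pderiv P) x \<noteq> 0"
  shows "G dvd 1"
proof -
  have "P \<noteq> 0" "R \<noteq> 0" using degP degR by auto
  then have deg: "degree (G * H) = degree R"
    using degree_separated_poly[of P R] degR FGH by simp
  then have "G \<noteq> 0" "H \<noteq> 0" using degR by auto
  then have deg_add: "degree G + degree H = degree R"
    using deg by (simp add: degree_mult_eq)
  have lc: "lead_coeff G * lead_coeff H = smult (lead_coeff R) P"
    using degR coeff_separated_poly[of P R "degree R"]
    by (simp add: FGH deg_add[symmetric] coeff_mult_degree_sum)
  \<comment> \<open>The degrees of \<open>G\<close> and \<open>H\<close> add up to at least 3, so
    the larger one is at least 2; a nonzero value here would force it down to 1.\<close>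
  have lcH: "poly (lead_coeff H) \<alpha> = 0" if "poly P \<alpha> = 0" for \<alpha>
    using degree_factor_separated_poly_le_1[of P R H G \<alpha>] that P0 FGH le degR deg_add
    by (auto simp: mult.commute)
  have lcG: "poly (lead_coeff G) \<alpha> \<noteq> 0" for \<alpha>
  proof
    assume G\<alpha>: "poly (lead_coeff G) \<alpha> = 0"
    have "lead_coeff R * poly P \<alpha> = 0"
      using G\<alpha> arg_cong[OF lc, of "\<lambda>p. poly p \<alpha>"] by simp
    then have P\<alpha>: "poly P \<alpha> = 0" using \<open>R \<noteq> 0\<close> by simp
    \<comment> \<open>Both leading coefficients vanish at \<alpha>, so \<alpha> is a double root of
      their product and the product rule kills the derivative there.\<close>
    have "lead_coeff R * poly (pderiv P) \<alpha> = 0"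
      using G\<alpha> lcH[OF P\<alpha>] arg_cong[OF lc, of "\<lambda>p. poly (pderiv p) \<alpha>"]
      by (simp add: pderiv_mult pderiv_smult)
    then show False using sep[OF P\<alpha>] \<open>R \<noteq> 0\<close> by simp
  qed
  \<comment> \<open>Over an algebraically closed field, a polynomial without roots is
    constant.\<close>
  have "degree (lead_coeff G) = 0"
    using alg_closed_imp_poly_has_root[of "lead_coeff G"] lcG by blast
  then obtain g where g: "lead_coeff G = [:g:]" by (rule degree_eq_zeroE)
  have "g \<noteq> 0" using \<open>G \<noteq> 0\<close> g by auto
  obtain \<alpha> where "poly P \<alpha> = 0"
    using alg_closed_imp_poly_has_root[of P] degP by auto
  then have "degree G \<le> 1"
    using degree_factor_separated_poly_le_1[OF FGH P0] lcG by blast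
  moreover have "degree G \<noteq> 1"
  proof
    assume "degree G = 1"
    then have G: "G = [:coeff G 0, [:g:]:]"
      using g by (intro poly_eqI) (auto simp: coeff_pCons coeff_eq_0 split: nat.split)
    \<comment> \<open>The root in Y of the linear polynomial \<open>G\<close>; it is a polynomial in
      X because the leading coefficient \<open>g\<close> is a nonzero constant.\<close>
    define s where "s = smult (- 1 / g) (coeff G 0)"
    have "poly G s = 0"
      by (subst G) (use \<open>g \<noteq> 0\<close> in \<open>simp add: s_def\<close>)
    then have eq: "P * pcompose R s = [:0, 1:] * s"
      using poly_separated_poly[of P R s] by (simp add: FGH)
    \<comment> \<open>Putting X = 0 in \<open>eq\<close> removes the right-hand side. As
      \<open>R\<close> does not vanish at 0, this yields that \<open>s\<close> is nonzero, which the
      degree count needs.\<close>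
    have "poly R (poly s 0) = 0"
      using P0 arg_cong[OF eq, of "\<lambda>p. poly p 0"] by (simp add: poly_pcompose)
    then have s0: "poly s 0 \<noteq> 0" using R0 by auto
    then have "s \<noteq> 0" by auto
    then have "P * pcompose R s \<noteq> 0" using eq by simp
    then have degs: "degree P + degree R * degree s = 1 + degree s"
      using arg_cong[OF eq, of degree] \<open>s \<noteq> 0\<close>
      by (simp add: degree_mult_eq degree_pcompose del: mult_pCons_left)
    show False
    \<comment> \<open>If \<open>s\<close> is a constant t, then R(s) is the constant R(t) = 0,
      although the product in \<open>eq\<close> is nonzero. Otherwise the left-hand side of
      \<open>degs\<close> is too large.\<close>
    proof (cases "degree s = 0")
      case True
      then obtain t where "s = [:t:]" by (rule degree_eq_zeroE)
      moreover have "pcompose R [:t:] = [:poly R t:]"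
        by (induction R) (simp_all add: pcompose_pCons)
      ultimately show False
        using \<open>poly R (poly s 0) = 0\<close> \<open>P * pcompose R s \<noteq> 0\<close> by simp
    next
      case False
      have "3 * degree s \<le> degree R * degree s" using degR by simp
      then show False using degs degP False by linarith
    qed
  qed
  ultimately have "degree G = 0" by simp
  then show ?thesis
    using g \<open>g \<noteq> 0\<close> by (auto elim!: degree_eq_zeroE simp: is_unit_const_poly_iff dvd_field_iff)
qed

lemma irreducible_separated_poly:
  fixes P R :: "'a::alg_closed_field poly"
  assumes "poly P 0 \<noteq> 0" "poly R 0 \<noteq> 0" "degree P \<ge> 1" "degree R \<ge> 3"
    and "\<And>x. poly P x = 0 \<Longrightarrow> poly (pderiv P) x \<noteq> 0"
  shows "Factorial_Ring.irreducible (separated_poly P R)"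
proof (rule Factorial_Ring.irreducibleI)
  have "P \<noteq> 0" using assms(3) by auto
  then have deg: "degree (separated_poly P R) = degree R"
    using assms(4) by (intro degree_separated_poly) auto
  then show "separated_poly P R \<noteq> 0" using assms(4) by auto
  show "\<not> separated_poly P R dvd 1"
    using deg assms(4) by (auto simp: is_unit_poly_iff)
  fix G H assume GH: "separated_poly P R = G * H"
  show "G dvd 1 \<or> H dvd 1"
  proof (cases "degree G \<le> degree H")
    case True
    then show ?thesis using smaller_factor_separated_poly_is_unit[OF GH] assms by blast
  next
    case False
    have "separated_poly P R = H * G" using GH by (simp add: mult.commute)
    then show ?thesis
      using smaller_factor_separated_poly_is_unit[of P R H G] False assms by auto
  qed
qed

text \<open>The characteristic is a prime dividing the cardinality.\<close>

lemma two_eq_0_if_CARD_power_2: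
  assumes "CARD('a::{field, finite}) = 2 ^ k"
  shows "(2 :: 'a) = 0"
proof -
  have "prime CHAR('a)"
    by (intro prime_CHAR_semidom finite_imp_CHAR_pos) simp
  moreover have "CHAR('a) dvd 2 ^ k"
    using CHAR_dvd_CARD[where 'a = 'a] assms by simp
  ultimately have "CHAR('a) = 2"
    by (metis prime_dvd_power primes_dvd_imp_eq two_is_prime_nat)
  then show ?thesis
    using of_nat_CHAR[where 'a = 'a] by simp
qed

definition trinomial :: "'a::comm_ring_1 \<Rightarrow> 'a \<Rightarrow> nat \<Rightarrow> 'a poly" where
  "trinomial b c n = monom c (n + 1) + monom b n + 1"

lemma degree_trinomial:
  assumes "c \<noteq> 0" "n > 0"
  shows "degree (trinomial b c n) = n + 1"
proof (rule antisym)
  show "degree (trinomial b c n) \<le> n + 1"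
    by (intro degree_le) (auto simp: trinomial_def)
  show "n + 1 \<le> degree (trinomial b c n)"
    using assms by (intro le_degree) (simp add: trinomial_def)
qed

lemma F_poly_eq_separated_poly:
  "F_poly q b c r = separated_poly (trinomial b c (2 ^ r)) (trinomial (b ^ q) (c ^ q) (2 ^ r))"
proof -
  have "bX ^ k = [:monom (1::'a) k:]" for k
    by (induction k) (simp_all add: bX_def monom_Suc one_pCons monom_0)
  then have X: "bconst a * bX ^ k = [:monom a k:]" for a :: 'a and k
    by (simp add: bconst_def smult_monom)
  have Y: "bconst a * bY ^ k = map_poly (\<lambda>a. [:a:]) (monom a k)" for a :: 'a and k
    by (subst map_poly_monom) (simp_all add: bconst_def bY_def monom_altdef)
  show ?thesis
    unfolding F_poly_def separated_poly_def trinomial_def X Y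
    by (simp add: map_poly_add_hom one_pCons map_poly_pCons)
qed

lemma map_poly_to_ac_F_poly:
  "map_poly (map_poly to_ac) (F_poly q b c r) = F_poly q (to_ac b) (to_ac c) r"
proof -
  \<comment> \<open>These instances handle the inner coefficient map and discharge the homomorphism
    premises raised by the outer one.\<close>
  note ac = map_poly_add_hom[of to_ac] map_poly_diff_hom[of to_ac] map_poly_mult_hom[of to_ac]
  show ?thesis
    by (simp add: F_poly_def map_poly_add_hom map_poly_diff_hom map_poly_mult_hom
        map_poly_power_hom ac bconst_def bX_def bY_def map_poly_pCons
        del: mult_pCons_left mult_pCons_right power_Suc)
qed

theorem theorem4p1:
  fixes m q r :: nat and b c :: "'a::{field, finite}"
  assumes "even m" and "m > 0"
    and "q = 2 ^ (m div 2)"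
    and "CARD('a) = q ^ 2"
    and "r \<ge> 1"
    and "c \<noteq> 0"
  shows "absolutely_irreducible (F_poly q b c r)"
proof -
  let ?P = "trinomial (to_ac b) (to_ac c) (2 ^ r)"
  let ?R = "trinomial (to_ac b ^ q) (to_ac c ^ q) (2 ^ r)"
  have "(2 :: 'a) = 0"
    using assms(3,4) by (intro two_eq_0_if_CARD_power_2[of "m div 2 * 2"]) (simp add: power_mult)
  then have two: "(2 :: 'a alg_closure) = 0"
    using to_ac_numeral[of "num.Bit0 num.One", where 'a = 'a] by simp
  \<comment> \<open>This makes the degree \<open>2 ^ r + 1\<close> of both trinomials at least
    3.\<close>
  have r2: "(2::nat) ^ r \<ge> 2"
    using assms(5) power_increasing[of 1 r "2::nat"] by simp
  have P0: "poly (trinomial x y (2 ^ r)) 0 \<noteq> 0" for x y :: "'a alg_closure"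
    using r2 by (simp add: trinomial_def poly_monom power_0_left)
  \<comment> \<open>In characteristic 2 the exponent \<open>2 ^ r\<close> becomes 0 and
    \<open>2 ^ r + 1\<close> becomes 1, as r \<ge> 1. The derivative thus vanishes only at 0, where
    \<open>?P\<close> takes the value 1, so \<open>?P\<close> is separable.\<close>
  have pderiv_P: "pderiv ?P = monom (to_ac c) (2 ^ r)"
    using two assms(5) by (simp add: trinomial_def pderiv_add pderiv_monom power_0_left)
  have "Factorial_Ring.irreducible (separated_poly ?P ?R)"
  proof (rule irreducible_separated_poly)
    show "poly (pderiv ?P) x \<noteq> 0" if "poly ?P x = 0" for x
      using that P0 assms(6) by (auto simp: pderiv_P poly_monom)
  qed (use P0 assms(6) r2 in \<open>simp_all add: degree_trinomial\<close>)
  then show ?thesis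
    unfolding absolutely_irreducible_def map_poly_to_ac_F_poly by (simp add: F_poly_eq_separated_poly)
qed

end
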